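(* Let $m<0<n$ be odd integers with $\gcd(m,n)=1$. Then the $\mathbb{Z}$-graded algebra $E_{(m,n)}^{(\infty,\infty)}$ generates the variety $\mathfrak{V}_2^{\mathbb{Z}}$; that is, $T_{\mathbb{Z}}(E_{(m,n)}^{(\infty,\infty)})=T_{\mathbb{Z}}(\mathfrak{V}_2^{\mathbb{Z}})$.
   Context: $F$ is a field of characteristic zero; all algebras are associative and unitary over $F$. $E$ is the infinite dimensional Grassmann algebra over $F$: $L$ is the vector space with basis $e_1,e_2,\ldots$, and $E$ has basis $B_E$ consisting of $1$ and all products $e_{i_1}\cdots e_{i_k}$ with $i_1<\cdots<i_k$, $k\ge 1$, with multiplication induced by $e_ie_j=-e_je_i$ for all $i,j$. The $\mathbb{Z}$-graded algebra $E_{(m,n)}^{(\infty,\infty)}=\bigoplus_{r\in\mathbb{Z}}A_r$: split the set $\{e_1,e_2,\ldots\}$ into two disjoint infinite subsets, spanning subspaces $L_m^{\infty}$ and $L_n^{\infty}$ with $L=L_m^{\infty}\oplus L_n^{\infty}$; set $\|e_k\|=m$ if $e_k\in L_m^\infty$ and $\|e_k\|=n$ if $e_k\in L_n^\infty$, and $\|e_{k_1}\cdots e_{k_s}\|=\|e_{k_1}\|+\cdots+\|e_{k_s}\|$ (and $\|1\|=0$); $A_r$ is the span of the elements of $B_E$ of degree $r$. Graded identities: $F\langle X|\mathbb{Z}\rangle$ is the free unitary associative algebra on the disjoint union $X=\bigcup_{i\in\mathbb{Z}}X_i$, $X_i=\{x_1^i,x_2^i,\ldots\}$, graded by giving the variables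 in $X_i$ degree $i$; $\alpha(x)$ denotes the $\mathbb{Z}$-degree of a variable $x$. $f(x_1^{l_1},\ldots,x_r^{l_r})$ is a graded identity of a $\mathbb{Z}$-graded algebra $A$ if $f(a_1,\ldots,a_r)=0$ for all $a_i\in A_{l_i}$; $T_{\mathbb{Z}}(A)$ is the set of all graded identities of $A$. A $T_{\mathbb{Z}}$-ideal is an ideal of $F\langle X|\mathbb{Z}\rangle$ invariant under all degree-preserving endomorphisms. $\mathfrak{V}_2^{\mathbb{Z}}$ is the variety of $\mathbb{Z}$-graded algebras defined by the identities $[x_1,x_2]$ whenever $\alpha(x_1)$ or $\alpha(x_2)$ is even, and $x_1x_2+x_2x_1$ whenever $\alpha(x_1)$ and $\alpha(x_2)$ are both odd; $T_{\mathbb{Z}}(\mathfrak{V}_2^{\mathbb{Z}})$ is the $T_{\mathbb{Z}}$-ideal generated by these polynomials. *)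

theory Defs
  imports
    "HOL-Library.Poly_Mapping"
    "HOL-Library.FSet"
    Complex_Main
begin

definition pm_scale :: "'f::field \<Rightarrow> ('b \<Rightarrow>\<^sub>0 'f) \<Rightarrow> ('b \<Rightarrow>\<^sub>0 'f)" where
  "pm_scale c p = Poly_Mapping.map (\<lambda>a. c * a) p"

lemma lookup_pm_scale [simp]:
  "Poly_Mapping.lookup (pm_scale c p) k = c * Poly_Mapping.lookup p k"
  by (simp add: pm_scale_def Poly_Mapping.map.rep_eq when_def)

global_interpretation pm: vector_space pm_scale
  by unfold_locales (auto intro!: poly_mapping_eqI simp: lookup_add algebra_simps)

lemma pm_scale_single: "pm_scale c (Poly_Mapping.single k a) = Poly_Mapping.single k (c * a)"
  by (rule poly_mapping_eqI) (simp add: lookup_single when_def)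

lemma pm_add_induct [case_names zero single add]:
  assumes "P 0" "\<And>k a. P (Poly_Mapping.single k a)" "\<And>p q. P p \<Longrightarrow> P q \<Longrightarrow> P (p + q)"
  shows "P (p :: 'b \<Rightarrow>\<^sub>0 'f::comm_monoid_add)"
proof (induction p rule: update_induct)
  case const
  show ?case by (rule assms(1))
next
  case (update p k v)
  have "Poly_Mapping.update k v p = Poly_Mapping.single k v + p"
    using update(1)
    by (intro poly_mapping_eqI)
      (auto simp: lookup_update lookup_add lookup_single when_def in_keys_iff)
  with update(3) assms(2,3) show ?case by simp
qed

text \<open>The finite set \<open>{i\<^sub>1 < \<dots> < i\<^sub>k}\<close> stands for the basis element
  \<open>e\<^sub>i\<^sub>1 \<cdots> e\<^sub>i\<^sub>k\<close> (the empty set for \<open>1\<close>). Reordering a product of two such elements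
  with \<open>e\<^sub>i e\<^sub>j = - e\<^sub>j e\<^sub>i\<close> costs one sign for each inversion, and
  the product vanishes if a generator is repeated.\<close>

definition inversions :: "nat fset \<Rightarrow> nat fset \<Rightarrow> (nat \<times> nat) set" where
  "inversions S T = {(i, j). i |\<in>| S \<and> j |\<in>| T \<and> j < i}"

definition gsign :: "nat fset \<Rightarrow> nat fset \<Rightarrow> 'f::field" where
  "gsign S T = (if S |\<inter>| T = {||} then (- 1) ^ card (inversions S T) else 0)"

definition gmult :: "(nat fset \<Rightarrow>\<^sub>0 'f::field) \<Rightarrow> (nat fset \<Rightarrow>\<^sub>0 'f) \<Rightarrow> (nat fset \<Rightarrow>\<^sub>0 'f)" where
  "gmult p q = (\<Sum>S\<in>Poly_Mapping.keys p. \<Sum>T\<in>Poly_Mapping.keys q.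
     Poly_Mapping.single (S |\<union>| T)
       (gsign S T * Poly_Mapping.lookup p S * Poly_Mapping.lookup q T))"

lemma finite_inversions: "finite (inversions S T)"
  by (rule finite_subset[of _ "fset S \<times> fset T"]) (auto simp: inversions_def)

lemma card_inversions_union_left:
  assumes "S |\<inter>| T = {||}"
  shows "card (inversions (S |\<union>| T) U) = card (inversions S U) + card (inversions T U)"
proof -
  have "inversions (S |\<union>| T) U = inversions S U \<union> inversions T U"
    by (auto simp: inversions_def)
  moreover have "inversions S U \<inter> inversions T U = {}"
    using assms by (auto simp: inversions_def)
  ultimately show ?thesis by (simp add: card_Un_disjoint finite_inversions)
qed

lemma card_inversions_union_right:
  assumes "T |\<inter>| U = {||}"
  shows "card (inversions S (T |\<union>| U)) = card (inversions S T) + card (inversions S U)"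
proof -
  have "inversions S (T |\<union>| U) = inversions S T \<union> inversions S U"
    by (auto simp: inversions_def)
  moreover have "inversions S T \<inter> inversions S U = {}"
    using assms by (auto simp: inversions_def)
  ultimately show ?thesis by (simp add: card_Un_disjoint finite_inversions)
qed

lemma gsign_assoc: "gsign S T * gsign (S |\<union>| T) U = gsign T U * (gsign S (T |\<union>| U) :: 'f::field)"
proof -
  have "(S |\<union>| T) |\<inter>| U = {||} \<longleftrightarrow> S |\<inter>| U = {||} \<and> T |\<inter>| U = {||}"
    and "S |\<inter>| (T |\<union>| U) = {||} \<longleftrightarrow> S |\<inter>| T = {||} \<and> S |\<inter>| U = {||}"
    by auto
  then show ?thesis
    by (auto simp: gsign_def card_inversions_union_left card_inversions_union_right
        simp flip: power_add) (simp add: add_ac)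
qed

lemma gsign_empty [simp]: "gsign {||} S = 1" "gsign S {||} = 1"
  by (simp_all add: gsign_def inversions_def)

lemma gmult_add_left: "gmult (p + q) r = gmult p r + gmult q r"
  unfolding gmult_def
  by (rule setsum_keys_plus_distrib) (simp_all add: algebra_simps single_add sum.distrib)

lemma gmult_add_right: "gmult r (p + q) = gmult r p + gmult r q"
  unfolding gmult_def sum.distrib[symmetric]
  by (intro sum.cong refl setsum_keys_plus_distrib) (simp_all add: algebra_simps single_add)

lemma gmult_zero [simp]: "gmult 0 p = 0" "gmult p 0 = 0"
  by (simp_all add: gmult_def)

lemma gmult_single:
  "gmult (Poly_Mapping.single S a) (Poly_Mapping.single T b) =
     Poly_Mapping.single (S |\<union>| T) (gsign S T * a * b)"
  by (simp add: gmult_def)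

lemma gmult_assoc: "gmult (gmult p q) r = gmult p (gmult q r)"
proof (induction p rule: pm_add_induct)
  case (single S a)
  show ?case
  proof (induction q rule: pm_add_induct)
    case (single T b)
    show ?case
    proof (induction r rule: pm_add_induct)
      case (single U c)
      have "gsign (S |\<union>| T) U * (gsign S T * a * b) * c =
          (gsign S T * gsign (S |\<union>| T) U) * (a * b * c)" by (simp add: ac_simps)
      also have "\<dots> = gsign S (T |\<union>| U) * a * (gsign T U * b * c)"
        by (subst gsign_assoc) (simp add: ac_simps)
      finally show ?case by (simp only: gmult_single sup_assoc)
    qed (simp_all add: gmult_add_left gmult_add_right)
  qed (simp_all add: gmult_add_left gmult_add_right)
qed (simp_all add: gmult_add_left gmult_add_right)

lemma gmult_one_left: "gmult (Poly_Mapping.single {||} 1) p = p"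
  by (induction p rule: pm_add_induct) (simp_all add: gmult_single gmult_add_right)

lemma gmult_one_right: "gmult p (Poly_Mapping.single {||} 1) = p"
  by (induction p rule: pm_add_induct) (simp_all add: gmult_single gmult_add_left)

lemma gmult_scale_left: "gmult (pm_scale c p) q = pm_scale c (gmult p q)"
proof (induction p rule: pm_add_induct)
  case (single S a)
  show ?case
    by (induction q rule: pm_add_induct)
      (simp_all add: pm_scale_single gmult_single gmult_add_right pm.scale_right_distrib ac_simps)
qed (simp_all add: gmult_add_left pm.scale_right_distrib)

lemma gmult_scale_right: "gmult p (pm_scale c q) = pm_scale c (gmult p q)"
proof (induction p rule: pm_add_induct)
  case (single S a)
  show ?case
    by (induction q rule: pm_add_induct)
      (simp_all add: pm_scale_single gmult_single gmult_add_right pm.scale_right_distrib ac_simps)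
qed (simp_all add: gmult_add_left pm.scale_right_distrib)

typedef (overloaded) 'f grassmann = "UNIV :: (nat fset \<Rightarrow>\<^sub>0 'f::field) set"
  morphisms gcoeffs Grassmann ..

setup_lifting type_definition_grassmann

instantiation grassmann :: (field) ring_1
begin

lift_definition zero_grassmann :: "'a grassmann" is 0 .
lift_definition one_grassmann :: "'a grassmann" is "Poly_Mapping.single {||} 1" .
lift_definition plus_grassmann :: "'a grassmann \<Rightarrow> 'a grassmann \<Rightarrow> 'a grassmann" is "(+)" .
lift_definition minus_grassmann :: "'a grassmann \<Rightarrow> 'a grassmann \<Rightarrow> 'a grassmann" is "(-)" .
lift_definition uminus_grassmann :: "'a grassmann \<Rightarrow> 'a grassmann" is uminus .
lift_definition times_grassmann :: "'a grassmann \<Rightarrow> 'a grassmann \<Rightarrow> 'a grassmann" is gmult .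

instance
proof
  show "(0::'a grassmann) \<noteq> 1"
    by transfer (metis lookup_single_eq lookup_zero zero_neq_one)
qed (transfer; simp add: gmult_assoc gmult_add_left gmult_add_right
      gmult_one_left gmult_one_right algebra_simps)+

end

lift_definition gscale :: "'f::field \<Rightarrow> 'f grassmann \<Rightarrow> 'f grassmann" is pm_scale .

global_interpretation grassmann: vector_space gscale
  by unfold_locales (transfer; simp add: pm.scale_right_distrib pm.scale_left_distrib)+

lemma gscale_mult_left: "gscale c x * y = gscale c (x * y)"
  by transfer (rule gmult_scale_left)

lemma gscale_mult_right: "x * gscale c y = gscale c (x * y)"
  by transfer (rule gmult_scale_right)

lift_definition gbasis :: "nat fset \<Rightarrow> 'f::field grassmann" is "\<lambda>S. Poly_Mapping.single S 1" .

lemma gbasis_empty: "gbasis {||} = 1"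
  by transfer simp

lemma gbasis_mult: "gbasis S * gbasis T = gscale (gsign S T) (gbasis (S |\<union>| T))"
  by transfer (simp add: gmult_single pm_scale_single)

lemma gbasis_anticommute: "gbasis {|i|} * gbasis {|j|} = - (gbasis {|j|} * gbasis {|i|})"
proof (cases "i = j")
  case True
  then show ?thesis by (simp add: gbasis_mult gsign_def)
next
  case False
  have *: "inversions {|k|} {|l|} = (if l < k then {(k, l)} else {})" for k l :: nat
    by (auto simp: inversions_def)
  from False show ?thesis
    by (auto simp: gbasis_mult gsign_def * finsert_commute)
qed

lemma gbasis_finsert_least:
  assumes "\<And>j. j |\<in>| S \<Longrightarrow> i < j"
  shows "gbasis (finsert i S) = gbasis {|i|} * gbasis S"
proof -
  have "inversions {|i|} S = {}" "i |\<notin>| S"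
    using assms by (auto simp: inversions_def dest: less_asym)
  then show ?thesis
    by (simp add: gbasis_mult gsign_def)
qed

text \<open>Here \<open>I\<close> is the set of all \<open>k\<close> with \<open>e\<^sub>k \<in> L\<^sub>m\<close>; the remaining
  generators lie in \<open>L\<^sub>n\<close>.\<close>

definition gdegree :: "int \<Rightarrow> int \<Rightarrow> nat set \<Rightarrow> nat fset \<Rightarrow> int" where
  "gdegree m n I S = (\<Sum>k\<in>fset S. if k \<in> I then m else n)"

definition gcomponent :: "int \<Rightarrow> int \<Rightarrow> nat set \<Rightarrow> int \<Rightarrow> 'f::field grassmann set" where
  "gcomponent m n I r = grassmann.span {gbasis S | S. gdegree m n I S = r}"

text \<open>\<open>Var l i\<close> is the variable \<open>x\<^sub>i\<^sup>l\<close>, of degree \<open>l\<close>.\<close>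

datatype gvar = Var (vdegree: int) (vindex: nat)

text \<open>The free monoid on \<open>'a\<close>, written additively so that the convolution product on
  finitely supported functions makes \<open>'a fmonoid \<Rightarrow>\<^sub>0 'f\<close> the monoid
  algebra, that is, the free unitary associative algebra on \<open>'a\<close>.\<close>

datatype 'a fmonoid = Word (letters: "'a list")

instantiation fmonoid :: (type) monoid_add
begin

definition zero_fmonoid :: "'a fmonoid" where "0 = Word []"
definition plus_fmonoid :: "'a fmonoid \<Rightarrow> 'a fmonoid \<Rightarrow> 'a fmonoid" where
  "v + w = Word (letters v @ letters w)"

instance
  by standard (simp_all add: zero_fmonoid_def plus_fmonoid_def)

end

type_synonym 'f gfree = "gvar fmonoid \<Rightarrow>\<^sub>0 'f"

definition monomial :: "gvar list \<Rightarrow> 'f::field gfree" where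
  "monomial xs = Poly_Mapping.single (Word xs) 1"

definition var :: "int \<Rightarrow> nat \<Rightarrow> 'f::field gfree" where
  "var l i = monomial [Var l i]"

definition fcomponent :: "int \<Rightarrow> 'f::field gfree set" where
  "fcomponent r = pm.span {monomial xs | xs. sum_list (map vdegree xs) = r}"

definition poly_eval ::
  "('f::field \<Rightarrow> 'a \<Rightarrow> 'a) \<Rightarrow> (gvar \<Rightarrow> 'a::ring_1) \<Rightarrow> 'f gfree \<Rightarrow> 'a" where
  "poly_eval scale \<phi> f =
     (\<Sum>w\<in>Poly_Mapping.keys f. scale (Poly_Mapping.lookup f w) (prod_list (map \<phi> (letters w))))"

definition graded_identities ::
  "('f::field \<Rightarrow> 'a \<Rightarrow> 'a) \<Rightarrow> (int \<Rightarrow> 'a::ring_1 set) \<Rightarrow> 'f gfree set" where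
  "graded_identities scale A =
     {f. \<forall>\<phi>. (\<forall>x. \<phi> x \<in> A (vdegree x)) \<longrightarrow> poly_eval scale \<phi> f = 0}"

definition graded_endo :: "('f::field gfree \<Rightarrow> 'f gfree) \<Rightarrow> bool" where
  "graded_endo \<psi> \<longleftrightarrow>
     (\<forall>p q. \<psi> (p + q) = \<psi> p + \<psi> q) \<and>
     (\<forall>p q. \<psi> (p * q) = \<psi> p * \<psi> q) \<and>
     (\<forall>c p. \<psi> (pm_scale c p) = pm_scale c (\<psi> p)) \<and>
     \<psi> 1 = 1 \<and>
     (\<forall>r. \<psi> ` fcomponent r \<subseteq> fcomponent r)"

definition two_sided_ideal :: "'a::ring_1 set \<Rightarrow> bool" where
  "two_sided_ideal J \<longleftrightarrow>
     0 \<in> J \<and> (\<forall>p\<in>J. \<forall>q\<in>J. p + q \<in> J) \<and> (\<forall>p\<in>J. \<forall>a. a * p \<in> J \<and> p * a \<in> J)"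

definition TZ_ideal :: "'f::field gfree set \<Rightarrow> bool" where
  "TZ_ideal J \<longleftrightarrow> two_sided_ideal J \<and> (\<forall>\<psi>. graded_endo \<psi> \<longrightarrow> \<psi> ` J \<subseteq> J)"

definition TZ_generated :: "'f::field gfree set \<Rightarrow> 'f gfree set" where
  "TZ_generated G = \<Inter>{J. TZ_ideal J \<and> G \<subseteq> J}"

text \<open>The degrees of the two variables range over all integers.\<close>

definition V2_identities :: "'f::field gfree set" where
  "V2_identities =
     {var k 1 * var l 2 - var l 2 * var k 1 | k l. even k \<or> even l} \<union>
     {var k 1 * var l 2 + var l 2 * var k 1 | k l. odd k \<and> odd l}"

end

theory Submission
  imports Defs "HOL-Library.Multiset" "HOL-Library.Countable" "HOL-Library.Disjoint_Sets"
begin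

text \<open>One inclusion is a computation: both \<open>m\<close> and \<open>n\<close> are odd, so the parity of the degree
  of a basis element is the parity of its length, and the identities of \<open>V2_identities\<close> state the
  usual supercommutativity of the Grassmann algebra (\<open>V2_subset_graded_identities\<close>).

  For the other inclusion, let \<open>J\<close> be the ideal generated by these identities. Modulo \<open>J\<close> a word
  may be reordered at the price of a sign (\<open>scalar_cong_mset\<close>), and a word with a repeated odd variable
  vanishes because \<open>2 x\<^sup>2 \<in> J\<close> (\<open>monomial_repeated_odd\<close>). So every polynomial is congruent to
  some \<open>g\<close> whose words have pairwise different contents, with each odd variable occurring at most
  once in a word (\<open>reduce_modulo_V2_ideal\<close>). It remains to see that such a \<open>g \<noteq> 0\<close> is not an
  identity (\<open>not_graded_identity_if_distinct_contents\<close>).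

  Take a shortest word \<open>w\<close> of \<open>g\<close>. Since \<open>m < 0 < n\<close> are coprime, every integer is
  \<open>a m + b n\<close> with \<open>a, b > 0\<close>; as there are infinitely many generators of either degree, every
  degree is realized by infinitely many nonempty, pairwise disjoint basis elements. Substitute for a
  variable \<open>x\<close> occurring \<open>k\<close> times in \<open>w\<close> the sum of \<open>k\<close> such elements, all of
  them disjoint also for different variables. A sum of \<open>k\<close> commuting elements of square zero has
  \<open>k\<close>-th power \<open>k!\<close> times their product and \<open>(k+1)\<close>-st power zero. Hence \<open>w\<close> takes
  a nonzero value, in characteristic zero, whereas any other word of \<open>g\<close>, being no shorter than
  \<open>w\<close> and of different content, contains some variable more often than \<open>w\<close> does and takes the
  value zero. So \<open>g\<close> takes a nonzero value.\<close>

section \<open>Evaluation\<close>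

text \<open>Used twice: polynomials are evaluated in the Grassmann algebra, and substitutions of
  variables are evaluations in the free algebra itself.\<close>

locale scalar_algebra = vector_space scale
  for scale :: "'f::field \<Rightarrow> 'a::ring_1 \<Rightarrow> 'a" +
  assumes scale_times_left: "scale c x * y = scale c (x * y)"
    and scale_times_right: "x * scale c y = scale c (x * y)"
begin

lemma poly_eval_0 [simp]: "poly_eval scale \<phi> 0 = 0"
  by (simp add: poly_eval_def)

lemma poly_eval_single:
  "poly_eval scale \<phi> (Poly_Mapping.single w c) = scale c (prod_list (map \<phi> (letters w)))"
  by (simp add: poly_eval_def)

lemma poly_eval_monomial: "poly_eval scale \<phi> (monomial xs) = prod_list (map \<phi> xs)"
  by (simp add: monomial_def poly_eval_single)

lemma poly_eval_1 [simp]: "poly_eval scale \<phi> 1 = 1"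
  using poly_eval_single[of \<phi> 0 1] by (simp add: zero_fmonoid_def[symmetric]) (simp add: zero_fmonoid_def)

lemma poly_eval_add: "poly_eval scale \<phi> (p + q) = poly_eval scale \<phi> p + poly_eval scale \<phi> q"
  unfolding poly_eval_def
  by (rule setsum_keys_plus_distrib) (simp_all add: scale_left_distrib)

lemma poly_eval_scale: "poly_eval scale \<phi> (pm_scale c p) = scale c (poly_eval scale \<phi> p)"
  by (induction p rule: pm_add_induct)
    (simp_all add: poly_eval_add pm.scale_right_distrib scale_right_distrib pm_scale_single
      poly_eval_single)

lemma poly_eval_minus: "poly_eval scale \<phi> (p - q) = poly_eval scale \<phi> p - poly_eval scale \<phi> q"
  by (metis add_diff_cancel_right' diff_add_cancel poly_eval_add)

lemma poly_eval_mult: "poly_eval scale \<phi> (p * q) = poly_eval scale \<phi> p * poly_eval scale \<phi> q"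
proof (induction p rule: pm_add_induct)
  case (single v a)
  show ?case
    by (induction q rule: pm_add_induct)
      (simp_all add: mult_single poly_eval_single plus_fmonoid_def scale_times_left
        scale_times_right distrib_left poly_eval_add)
qed (simp_all add: distrib_right poly_eval_add)

end

lemma monomial_append: "monomial (xs @ ys) = monomial xs * monomial ys"
  by (simp add: monomial_def mult_single plus_fmonoid_def)

lemma monomial_Nil: "monomial [] = 1"
  by (simp add: monomial_def flip: zero_fmonoid_def)

lemma single_eq_scale_monomial: "Poly_Mapping.single w c = pm_scale c (monomial (letters w))"
  by (simp add: monomial_def pm_scale_single)

lemma pm_scale_eq_mult: "pm_scale c p = Poly_Mapping.single 0 c * (p :: 'f::field gfree)"
proof (induction p rule: pm_add_induct)
  case (single k a)
  then show ?case by (simp add: pm_scale_single mult_single)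
qed (simp_all add: pm.scale_right_distrib distrib_left)

global_interpretation gfree: scalar_algebra "pm_scale :: 'f::field \<Rightarrow> 'f gfree \<Rightarrow> 'f gfree"
proof
  fix c :: 'f and x y :: "'f gfree"
  show "pm_scale c x * y = pm_scale c (x * y)"
    by (simp add: pm_scale_eq_mult mult.assoc)
  show "x * pm_scale c y = pm_scale c (x * y)"
  proof (induction x rule: pm_add_induct)
    case (single k a)
    show ?case
      by (induction y rule: pm_add_induct)
        (simp_all add: pm_scale_single mult_single distrib_left pm.scale_right_distrib mult_ac)
  qed (simp_all add: pm.scale_right_distrib distrib_right)
qed

global_interpretation grassmann: scalar_algebra "gscale :: 'f::field \<Rightarrow> 'f grassmann \<Rightarrow> 'f grassmann"
  by unfold_locales (rule gscale_mult_left gscale_mult_right)+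

text \<open>An endomorphism followed by an evaluation is again an evaluation, at the images of the
  variables. This is why the identities of an algebra are stable under endomorphisms.\<close>

lemma poly_eval_graded_endo:
  assumes "graded_endo \<psi>"
  shows "poly_eval gscale \<phi> (\<psi> f) = poly_eval gscale (\<lambda>x. poly_eval gscale \<phi> (\<psi> (monomial [x]))) f"
proof -
  have add: "\<psi> (p + q) = \<psi> p + \<psi> q" and mult: "\<psi> (p * q) = \<psi> p * \<psi> q"
    and scale: "\<psi> (pm_scale c p) = pm_scale c (\<psi> p)" and one: "\<psi> 1 = 1" for p q c
    using assms by (auto simp: graded_endo_def)
  have zero: "\<psi> 0 = 0" using add[of 0 0] by simp
  have mon: "poly_eval gscale \<phi> (\<psi> (monomial xs)) =
      prod_list (map (\<lambda>x. poly_eval gscale \<phi> (\<psi> (monomial [x]))) xs)" for xs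
  proof (induction xs)
    case Nil
    then show ?case by (simp add: monomial_Nil one)
  next
    case (Cons x xs)
    have "monomial (x # xs) = monomial [x] * (monomial xs :: 'a gfree)"
      using monomial_append[of "[x]" xs] by simp
    then show ?case by (simp add: mult grassmann.poly_eval_mult Cons)
  qed
  show ?thesis
  proof (induction f rule: pm_add_induct)
    case (single w a)
    show ?case
      unfolding single_eq_scale_monomial scale grassmann.poly_eval_scale mon[of "letters w"]
        grassmann.poly_eval_monomial ..
  qed (simp_all add: zero add grassmann.poly_eval_add)
qed

lemma monomial_in_fcomponent: "monomial xs \<in> fcomponent (sum_list (map vdegree xs))"
  unfolding fcomponent_def by (intro pm.span_base) blast

lemma graded_endo_rename:
  assumes "\<And>x. vdegree (\<rho> x) = vdegree x"
  shows "graded_endo (poly_eval pm_scale (\<lambda>x. monomial [\<rho> x]) :: 'f::field gfree \<Rightarrow> 'f gfree)"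
proof -
  let ?\<psi> = "poly_eval pm_scale (\<lambda>x. monomial [\<rho> x]) :: 'f gfree \<Rightarrow> 'f gfree"
  have mon: "?\<psi> (monomial xs) = monomial (map \<rho> xs)" for xs
  proof (induction xs)
    case (Cons x xs)
    then show ?case
      using monomial_append[of "[\<rho> x]" "map \<rho> xs"]
      by (simp add: gfree.poly_eval_monomial flip: monomial_append)
  qed (simp add: monomial_Nil)
  have "?\<psi> p \<in> fcomponent r" if "p \<in> fcomponent r" for p r
    using that unfolding fcomponent_def[of r]
  proof (induction rule: pm.span_induct_alt)
    case base
    show ?case by (simp add: pm.span_zero)
  next
    case (step c p q)
    then obtain xs where xs: "p = monomial xs" "sum_list (map vdegree xs) = r" by blast
    have "map vdegree (map \<rho> xs) = map vdegree xs" using assms by simp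
    then have "?\<psi> p \<in> fcomponent r"
      using monomial_in_fcomponent[of "map \<rho> xs"] xs by (simp add: mon del: map_map)
    then show ?case
      using step by (simp add: gfree.poly_eval_add gfree.poly_eval_scale fcomponent_def
          pm.span_add pm.span_scale)
  qed
  then show ?thesis
    unfolding graded_endo_def
    by (auto simp: gfree.poly_eval_add gfree.poly_eval_mult gfree.poly_eval_scale)
qed

section \<open>Supercommutativity\<close>

text \<open>For disjoint \<open>S\<close> and \<open>T\<close> each pair in \<open>S \<times> T\<close> is an inversion in exactly
  one of the two orders.\<close>

lemma gsign_commute: "gsign S T = (- 1) ^ (fcard S * fcard T) * (gsign T S :: 'f::field)"
proof (cases "S |\<inter>| T = {||}")
  case True
  have "fset S \<times> fset T = inversions S T \<union> prod.swap ` inversions T S"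
  proof -
    have "i < j \<or> j < i" if "i |\<in>| S" "j |\<in>| T" for i j
      using that True by (metis fempty_iff finter_iff linorder_neqE_nat)
    then show ?thesis by (auto simp: inversions_def image_iff) blast
  qed
  moreover have "inversions S T \<inter> prod.swap ` inversions T S = {}"
    by (auto simp: inversions_def)
  ultimately have "fcard S * fcard T = card (inversions S T) + card (inversions T S)"
    by (simp add: fcard.rep_eq card_Un_disjoint finite_inversions card_image
        flip: card_cartesian_product)
  then show ?thesis
    using True by (simp add: gsign_def inf_commute power_add mult.assoc flip: power_mult_distrib)
next
  case False
  then show ?thesis by (auto simp: gsign_def inf_commute)
qed

lemma even_gdegree_iff:
  assumes "odd m" "odd n"
  shows "even (gdegree m n I S) \<longleftrightarrow> even (fcard S)"
proof (induction S)
  case empty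
  show ?case by (simp add: gdegree_def fcard.rep_eq)
next
  case (insert x S)
  then show ?case using assms by (simp add: gdegree_def fcard_finsert_disjoint)
qed

lemma gcomponent_supercommute:
  assumes "odd m" "odd n" "x \<in> gcomponent m n I r" "y \<in> gcomponent m n I s"
  shows "x * y = gscale (if odd r \<and> odd s then - 1 else 1 :: 'f::field) (y * x)"
  using assms(3) unfolding gcomponent_def
proof (induction rule: grassmann.span_induct_alt)
  case (step c p q)
  then obtain S where p: "p = gbasis S" and S: "gdegree m n I S = r" by blast
  have "p * y = gscale (if odd r \<and> odd s then - 1 else 1) (y * p)"
    using assms(4) unfolding gcomponent_def
  proof (induction rule: grassmann.span_induct_alt)
    case (step d u v)
    then obtain T where u: "u = gbasis T" and T: "gdegree m n I T = s" by blast
    have "(- 1) ^ (fcard S * fcard T) = (if odd r \<and> odd s then - 1 else 1 :: 'f)"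
      using even_gdegree_iff[OF assms(1,2), of I S] even_gdegree_iff[OF assms(1,2), of I T] S T
      by (auto simp: minus_one_power_iff)
    then have "p * u = gscale (if odd r \<and> odd s then - 1 else 1) (u * p)"
      unfolding p u gbasis_mult using gsign_commute[of S T, where 'f = 'f]
      by (simp add: sup_commute)
    then show ?case
      using step by (simp add: distrib_left distrib_right gscale_mult_left gscale_mult_right
          grassmann.scale_right_distrib grassmann.scale_left_commute mult.commute)
  qed simp
  with step show ?case
    by (simp add: distrib_left distrib_right gscale_mult_left gscale_mult_right
        grassmann.scale_right_distrib grassmann.scale_left_commute mult.commute)
qed simp

lemma gdegree_union:
  assumes "S |\<inter>| T = {||}"
  shows "gdegree m n I (S |\<union>| T) = gdegree m n I S + gdegree m n I T"
  using assms unfolding gdegree_def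
  by (auto intro!: sum.union_disjoint)

lemma gbasis_in_gcomponent: "gbasis S \<in> gcomponent m n I (gdegree m n I S)"
  unfolding gcomponent_def by (intro grassmann.span_base) blast

lemma gcomponent_mult:
  assumes "x \<in> gcomponent m n I r" "y \<in> gcomponent m n I s"
  shows "x * y \<in> gcomponent m n I (r + s)"
  using assms(1) unfolding gcomponent_def[of _ _ _ r]
proof (induction rule: grassmann.span_induct_alt)
  case base
  show ?case by (simp add: gcomponent_def grassmann.span_zero)
next
  case (step c p q)
  then obtain S where p: "p = gbasis S" and S: "gdegree m n I S = r" by blast
  have "p * y \<in> gcomponent m n I (r + s)"
    using assms(2) unfolding gcomponent_def[of _ _ _ s]
  proof (induction rule: grassmann.span_induct_alt)
    case base
    show ?case by (simp add: gcomponent_def grassmann.span_zero)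
  next
    case (step d u v)
    then obtain T where u: "u = gbasis T" and T: "gdegree m n I T = s" by blast
    have "p * u \<in> gcomponent m n I (r + s)"
    proof (cases "S |\<inter>| T = {||}")
      case True
      then have "gdegree m n I (S |\<union>| T) = r + s" using S T by (simp add: gdegree_union)
      then show ?thesis
        using gbasis_in_gcomponent[of "S |\<union>| T" m n I] unfolding p u gbasis_mult gcomponent_def
        by (auto intro: grassmann.span_scale)
    next
      case False
      then show ?thesis by (simp add: p u gbasis_mult gsign_def gcomponent_def grassmann.span_zero)
    qed
    with step show ?case
      by (simp add: distrib_left gscale_mult_right gcomponent_def grassmann.span_add
          grassmann.span_scale)
  qed
  with step show ?case
    by (simp add: distrib_right gscale_mult_left gcomponent_def grassmann.span_add
        grassmann.span_scale)
qed

lemma poly_eval_in_gcomponent: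
  assumes "\<And>x. \<phi> x \<in> gcomponent m n I (vdegree x)" "p \<in> fcomponent r"
  shows "poly_eval gscale \<phi> p \<in> gcomponent m n I r"
  using assms(2) unfolding fcomponent_def
proof (induction rule: pm.span_induct_alt)
  case base
  show ?case by (simp add: gcomponent_def grassmann.span_zero)
next
  case (step c p q)
  then obtain xs where xs: "p = monomial xs" "sum_list (map vdegree xs) = r" by blast
  have "prod_list (map \<phi> xs) \<in> gcomponent m n I (sum_list (map vdegree xs))" for xs
  proof (induction xs)
    case Nil
    show ?case using gbasis_in_gcomponent[of "{||}"] by (simp add: gbasis_empty gdegree_def)
  next
    case (Cons x xs)
    then show ?case using assms(1) by (simp add: gcomponent_mult)
  qed
  then have "poly_eval gscale \<phi> p \<in> gcomponent m n I r"
    using xs by (metis grassmann.poly_eval_monomial)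
  with step show ?case
    by (simp add: grassmann.poly_eval_add grassmann.poly_eval_scale gcomponent_def
        grassmann.span_add grassmann.span_scale)
qed

lemma TZ_ideal_graded_identities:
  "TZ_ideal (graded_identities gscale (gcomponent m n I :: int \<Rightarrow> 'f::field grassmann set))"
    (is "TZ_ideal ?T")
proof -
  have "\<psi> f \<in> ?T" if \<psi>: "graded_endo \<psi>" and f: "f \<in> ?T" for \<psi> f
  proof -
    have "poly_eval gscale \<phi> (\<psi> f) = 0" if \<phi>: "\<And>x. \<phi> x \<in> gcomponent m n I (vdegree x)" for \<phi>
    proof -
      have "poly_eval gscale \<phi> (\<psi> (monomial [x])) \<in> gcomponent m n I (vdegree x)" for x
      proof (rule poly_eval_in_gcomponent[OF \<phi>])
        show "\<psi> (monomial [x]) \<in> fcomponent (vdegree x)"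
          using \<psi> monomial_in_fcomponent[of "[x]"] unfolding graded_endo_def by force
      qed
      then show ?thesis
        using f unfolding poly_eval_graded_endo[OF \<psi>, of \<phi> f]
        by (simp add: graded_identities_def)
    qed
    then show ?thesis by (simp add: graded_identities_def)
  qed
  moreover have "two_sided_ideal ?T"
    by (simp add: two_sided_ideal_def graded_identities_def grassmann.poly_eval_add
        grassmann.poly_eval_mult)
  ultimately show ?thesis by (auto simp: TZ_ideal_def)
qed

lemma V2_subset_graded_identities:
  assumes "odd m" "odd n"
  shows "V2_identities \<subseteq> graded_identities gscale (gcomponent m n I :: int \<Rightarrow> 'f::field grassmann set)"
proof
  fix f :: "'f gfree" assume "f \<in> V2_identities"
  then obtain k l where f: "f = var k 1 * var l 2 - pm_scale (if odd k \<and> odd l then - 1 else 1) (var l 2 * var k 1)"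
  proof -
    consider (commute) k l where "f = var k 1 * var l 2 - var l 2 * var k 1" "even k \<or> even l"
      | (anticommute) k l where "f = var k 1 * var l 2 + var l 2 * var k 1" "odd k \<and> odd l"
      using \<open>f \<in> V2_identities\<close> unfolding V2_identities_def by blast
    then show thesis
    proof cases
      case commute
      then show thesis by (intro that[of k l]) auto
    next
      case anticommute
      then show thesis by (intro that[of k l]) auto
    qed
  qed
  have "poly_eval gscale \<phi> f = 0" if \<phi>: "\<And>x. \<phi> x \<in> gcomponent m n I (vdegree x)" for \<phi>
  proof -
    have "\<phi> (Var k 1) * \<phi> (Var l 2) =
        gscale (if odd k \<and> odd l then - 1 else 1) (\<phi> (Var l 2) * \<phi> (Var k 1))"
      using \<phi>[of "Var k 1"] \<phi>[of "Var l 2"] unfolding gvar.sel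
      by (rule gcomponent_supercommute[OF assms])
    then show ?thesis
      unfolding f var_def grassmann.poly_eval_minus grassmann.poly_eval_scale
        grassmann.poly_eval_mult grassmann.poly_eval_monomial
      by (simp only: list.map prod_list.Nil prod_list.Cons mult_1_right diff_self)
  qed
  then show "f \<in> graded_identities gscale (gcomponent m n I)"
    by (simp add: graded_identities_def)
qed

section \<open>Consequences of the defining identities\<close>

lemma TZ_ideal_generated: "TZ_ideal (TZ_generated G)"
proof -
  have "two_sided_ideal (TZ_generated G)"
    unfolding TZ_generated_def two_sided_ideal_def
    by (auto simp: TZ_ideal_def two_sided_ideal_def)
  moreover have "\<psi> ` TZ_generated G \<subseteq> TZ_generated G" if "graded_endo \<psi>" for \<psi>
    using that unfolding TZ_generated_def by (auto simp: TZ_ideal_def)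
  ultimately show ?thesis by (simp add: TZ_ideal_def)
qed

lemma TZ_generated_superset: "G \<subseteq> TZ_generated G"
  unfolding TZ_generated_def by blast

lemma TZ_generated_least: "TZ_ideal J \<Longrightarrow> G \<subseteq> J \<Longrightarrow> TZ_generated G \<subseteq> J"
  unfolding TZ_generated_def by blast

lemma TZ_ideal_add: "TZ_ideal J \<Longrightarrow> p \<in> J \<Longrightarrow> q \<in> J \<Longrightarrow> p + q \<in> J"
  by (simp add: TZ_ideal_def two_sided_ideal_def)

lemma TZ_ideal_mult: "TZ_ideal J \<Longrightarrow> p \<in> J \<Longrightarrow> a * p * b \<in> J"
  by (simp add: TZ_ideal_def two_sided_ideal_def)

lemma TZ_ideal_scale: "TZ_ideal J \<Longrightarrow> p \<in> J \<Longrightarrow> pm_scale c p \<in> J"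
  by (simp add: TZ_ideal_def two_sided_ideal_def pm_scale_eq_mult)

lemma TZ_ideal_uminus: "TZ_ideal J \<Longrightarrow> p \<in> J \<Longrightarrow> - p \<in> J"
  using TZ_ideal_scale[of J p "- 1"] by simp

lemma TZ_ideal_diff: "TZ_ideal J \<Longrightarrow> p \<in> J \<Longrightarrow> q \<in> J \<Longrightarrow> p - q \<in> J"
  using TZ_ideal_add[of J p "- q"] TZ_ideal_uminus[of J q] by simp

abbreviation V2_ideal :: "'f::field gfree set" where
  "V2_ideal \<equiv> TZ_generated V2_identities"

text \<open>The generators involve two fixed variables of each pair of degrees; a degree-preserving
  renaming gives the relation for arbitrary variables, also for \<open>x = y\<close>.\<close>

lemma V2_ideal_swap:
  "monomial [x, y] - pm_scale (if odd (vdegree x) \<and> odd (vdegree y) then - 1 else 1) (monomial [y, x])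
    \<in> (V2_ideal :: 'f::field gfree set)"
proof -
  obtain k i where x: "x = Var k i" by (cases x)
  obtain l j where y: "y = Var l j" by (cases y)
  define \<rho> where "\<rho> z = (if z = Var k 1 then x else if z = Var l 2 then y else z)" for z
  let ?\<psi> = "poly_eval pm_scale (\<lambda>x. monomial [\<rho> x]) :: 'f gfree \<Rightarrow> 'f gfree"
  let ?c = "if odd k \<and> odd l then - 1 else 1 :: 'f"
  let ?g = "var k 1 * var l 2 - pm_scale ?c (var l 2 * var k 1)"
  have "graded_endo ?\<psi>"
    by (rule graded_endo_rename) (auto simp: \<rho>_def x y)
  moreover have "?g \<in> V2_ideal"
    by (rule subsetD[OF TZ_generated_superset]) (auto simp: V2_identities_def)
  ultimately have "?\<psi> ?g \<in> V2_ideal"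
    using TZ_ideal_generated unfolding TZ_ideal_def by blast
  also have "?\<psi> ?g = monomial [x, y] - pm_scale ?c (monomial [y, x])"
    by (simp add: var_def gfree.poly_eval_minus gfree.poly_eval_mult gfree.poly_eval_scale
        gfree.poly_eval_monomial \<rho>_def del: if_split flip: monomial_append)
  finally show ?thesis by (simp add: x y)
qed

text \<open>The scalar is always a sign, but only its being nonzero matters. The first argument fixes the
  ground field, which the words do not mention.\<close>

definition scalar_cong :: "'f::field itself \<Rightarrow> gvar list \<Rightarrow> gvar list \<Rightarrow> bool" where
  "scalar_cong F u v \<longleftrightarrow> (\<exists>c::'f. c \<noteq> 0 \<and> monomial u - pm_scale c (monomial v) \<in> V2_ideal)"

lemma scalar_cong_refl: "scalar_cong F u u"
  using TZ_ideal_generated[of V2_identities]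
  by (auto simp: scalar_cong_def TZ_ideal_def two_sided_ideal_def intro!: exI[of _ 1])

lemma scalar_cong_trans:
  fixes F :: "'f::field itself"
  assumes "scalar_cong F u v" "scalar_cong F v w"
  shows "scalar_cong F u w"
proof -
  obtain c d :: 'f where "c \<noteq> 0" "d \<noteq> 0" and c: "monomial u - pm_scale c (monomial v) \<in> V2_ideal"
    and d: "monomial v - pm_scale d (monomial w) \<in> V2_ideal"
    using assms by (auto simp: scalar_cong_def)
  have "monomial u - pm_scale (c * d) (monomial w) =
      (monomial u - pm_scale c (monomial v)) + pm_scale c (monomial v - pm_scale d (monomial w))"
    by (simp add: pm.scale_right_diff_distrib)
  also have "\<dots> \<in> V2_ideal"
    by (intro TZ_ideal_add[OF TZ_ideal_generated] TZ_ideal_scale[OF TZ_ideal_generated] c d)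
  finally show ?thesis
    using \<open>c \<noteq> 0\<close> \<open>d \<noteq> 0\<close> unfolding scalar_cong_def by (intro exI[of _ "c * d"]) simp
qed

lemma scalar_cong_context:
  fixes F :: "'f::field itself"
  assumes "scalar_cong F u v"
  shows "scalar_cong F (xs @ u @ ys) (xs @ v @ ys)"
proof -
  obtain c :: 'f where "c \<noteq> 0" and c: "monomial u - pm_scale c (monomial v) \<in> V2_ideal"
    using assms by (auto simp: scalar_cong_def)
  have "monomial (xs @ u @ ys) - pm_scale c (monomial (xs @ v @ ys)) =
      monomial xs * (monomial u - pm_scale c (monomial v)) * monomial ys"
    by (simp add: monomial_append algebra_simps gfree.scale_times_left gfree.scale_times_right)
  also have "\<dots> \<in> V2_ideal" by (rule TZ_ideal_mult[OF TZ_ideal_generated c])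
  finally show ?thesis using \<open>c \<noteq> 0\<close> unfolding scalar_cong_def by blast
qed

lemma scalar_cong_move: "scalar_cong F (x # v @ w) (v @ x # w)"
proof (induction v)
  case Nil
  show ?case by (simp add: scalar_cong_refl)
next
  case (Cons y v)
  have "scalar_cong F [x, y] [y, x]"
    unfolding scalar_cong_def by (rule exI, rule conjI[rotated], rule V2_ideal_swap) simp
  then have "scalar_cong F (x # (y # v) @ w) (y # x # v @ w)"
    using scalar_cong_context[of F "[x, y]" "[y, x]" "[]" "v @ w"] by simp
  moreover have "scalar_cong F (y # x # v @ w) ((y # v) @ x # w)"
    using scalar_cong_context[OF Cons, of "[y]" "[]"] by simp
  ultimately show ?case by (rule scalar_cong_trans)
qed

lemma scalar_cong_mset: "mset u = mset v \<Longrightarrow> scalar_cong F u v"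
proof (induction u arbitrary: v)
  case Nil
  then show ?case by (simp add: scalar_cong_refl)
next
  case (Cons x u)
  then have "x \<in> set v" by (metis list.set_intros(1) set_mset_mset)
  then obtain v1 v2 where v: "v = v1 @ x # v2" by (meson split_list)
  then have "scalar_cong F u (v1 @ v2)" using Cons by simp
  from scalar_cong_context[OF this, of "[x]" "[]"]
  have "scalar_cong F (x # u) (x # v1 @ v2)" by simp
  then show ?case unfolding v using scalar_cong_move by (rule scalar_cong_trans)
qed

text \<open>Reordering factors in the Grassmann algebra is inherited from reordering words modulo the
  ideal, all of whose elements are identities.\<close>

lemma prod_list_values_perm:
  fixes \<phi> :: "gvar \<Rightarrow> 'f::field grassmann"
  assumes "odd m" "odd n" "\<And>x. \<phi> x \<in> gcomponent m n I (vdegree x)" "mset u = mset v"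
  shows "\<exists>c. c \<noteq> 0 \<and> prod_list (map \<phi> u) = gscale c (prod_list (map \<phi> v))"
proof -
  obtain c :: 'f where "c \<noteq> 0" and c: "monomial u - pm_scale c (monomial v) \<in> V2_ideal"
    using scalar_cong_mset[OF assms(4), of "TYPE('f)"] unfolding scalar_cong_def by blast
  have "monomial u - pm_scale c (monomial v) \<in> graded_identities gscale (gcomponent m n I)"
    using c TZ_generated_least[OF TZ_ideal_graded_identities V2_subset_graded_identities[OF assms(1,2)]]
    by blast
  then have "poly_eval gscale \<phi> (monomial u - pm_scale c (monomial v)) = 0"
    using assms(3) by (simp add: graded_identities_def)
  then show ?thesis using \<open>c \<noteq> 0\<close>
    by (auto simp: grassmann.poly_eval_minus grassmann.poly_eval_scale grassmann.poly_eval_monomial)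
qed

lemma monomial_repeated_odd:
  assumes "odd (vdegree x)" "count (mset w) x \<ge> 2"
  shows "monomial w \<in> (V2_ideal :: 'f::field_char_0 gfree set)"
proof -
  have "replicate_mset 2 x \<subseteq># mset w"
    using assms(2) by (simp add: count_le_replicate_mset_subset_eq)
  then obtain M where "mset w = replicate_mset 2 x + M" by (metis subset_mset.le_iff_add)
  moreover obtain v where "mset v = M" by (metis ex_mset)
  ultimately have "mset w = mset ([x, x] @ v)" by (simp add: numeral_2_eq_2)
  then obtain c where c: "monomial w - pm_scale c (monomial ([x, x] @ v)) \<in> (V2_ideal :: 'f gfree set)"
    using scalar_cong_mset[of w _ "TYPE('f)"] unfolding scalar_cong_def by blast
  have "monomial [x, x] + monomial [x, x] \<in> (V2_ideal :: 'f gfree set)"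
    using V2_ideal_swap[of x x, where 'f = 'f] assms(1) by simp
  then have "pm_scale (1/2) (monomial [x, x] + monomial [x, x]) \<in> (V2_ideal :: 'f gfree set)"
    by (rule TZ_ideal_scale[OF TZ_ideal_generated])
  also have "pm_scale (1/2) (monomial [x, x] + monomial [x, x]) = (monomial [x, x] :: 'f gfree)"
    by (rule poly_mapping_eqI) (simp add: lookup_add)
  finally have "1 * monomial [x, x] * monomial v \<in> (V2_ideal :: 'f gfree set)"
    by (rule TZ_ideal_mult[OF TZ_ideal_generated])
  then have "pm_scale c (monomial ([x, x] @ v)) \<in> (V2_ideal :: 'f gfree set)"
    by (intro TZ_ideal_scale[OF TZ_ideal_generated]) (simp flip: monomial_append)
  from TZ_ideal_add[OF TZ_ideal_generated c this] show ?thesis by simp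
qed

section \<open>Generic values\<close>

text \<open>Opposite signs allow adding a large multiple of \<open>(n, - m)\<close> to any integer solution. Both
  coefficients being positive, the case \<open>d = 0\<close> yields a basis element other than \<open>1\<close>.\<close>

lemma exists_positive_combination:
  fixes m n d :: int
  assumes "m < 0" "0 < n" "gcd m n = 1"
  shows "\<exists>a b::nat. 0 < a \<and> 0 < b \<and> int a * m + int b * n = d"
proof -
  obtain u v where uv: "u * m + v * n = 1" using bezout_int[of m n] assms(3) by auto
  define t where "t = \<bar>d * u\<bar> + \<bar>d * v\<bar> + 1"
  have "t \<le> t * n" "t \<le> t * - m"
    using assms(1,2) mult_left_mono[of 1 n t] mult_left_mono[of 1 "- m" t] by (simp_all add: t_def)
  moreover have "0 < d * u + t" "0 < d * v + t" by (simp_all add: t_def)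
  ultimately have "0 < d * u + t * n" "0 < d * v - t * m" by simp_all
  moreover have "(d * u + t * n) * m + (d * v - t * m) * n = d * (u * m + v * n)"
    by (simp add: algebra_simps)
  ultimately show ?thesis
    by (intro exI[of _ "nat (d * u + t * n)"] exI[of _ "nat (d * v - t * m)"]) (simp add: uv)
qed

text \<open>Both sorts of generators are arranged in a matrix with rows indexed by \<open>'i\<close>, and the
  \<open>i\<close>-th basis element takes sufficiently many generators from the \<open>i\<close>-th rows. Nonemptiness
  makes the squares of these basis elements vanish.\<close>

lemma exists_disjoint_family_of_degrees:
  fixes d :: "'i::countable \<Rightarrow> int"
  assumes "m < 0" "0 < n" "gcd m n = 1" "infinite I" "infinite (- I)"
  shows "\<exists>S. (\<forall>i. S i \<noteq> {||} \<and> gdegree m n I (S i) = d i) \<and> (\<forall>i j. i \<noteq> j \<longrightarrow> S i |\<inter>| S j = {||})"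
proof -
  obtain a b :: "'i \<Rightarrow> nat" where ab: "0 < a i" "int (a i) * m + int (b i) * n = d i" for i
  proof -
    have "\<forall>i. \<exists>a b::nat. 0 < a \<and> 0 < b \<and> int a * m + int b * n = d i"
      using exists_positive_combination[OF assms(1-3)] by blast
    then show thesis using that by metis
  qed
  obtain f g :: "nat \<Rightarrow> nat" where f: "inj f" "range f \<subseteq> I" and g: "inj g" "range g \<subseteq> - I"
    using infinite_countable_subset[OF assms(4)] infinite_countable_subset[OF assms(5)] by blast
  \<comment> \<open>the number of the entry in row \<open>i\<close> and column \<open>t\<close>\<close>
  define e where "e i t = prod_encode (to_nat i, t)" for i :: 'i and t
  have e: "e i t = e j u \<longleftrightarrow> i = j \<and> t = u" for i j t u by (simp add: e_def)
  define A where "A i = (\<lambda>t. f (e i t)) ` {..<a i}" for i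
  define B where "B i = (\<lambda>t. g (e i t)) ` {..<b i}" for i
  define S where "S i = Abs_fset (A i \<union> B i)" for i
  have S: "fset (S i) = A i \<union> B i" for i
    unfolding S_def by (rule Abs_fset_inverse) (simp add: A_def B_def)
  have sub: "A i \<subseteq> I" "B i \<subseteq> - I" for i using f g by (auto simp: A_def B_def)
  have "inj_on (\<lambda>t. f (e i t)) X" "inj_on (\<lambda>t. g (e i t)) X" for i X
    by (auto simp: inj_on_def inj_eq[OF f(1)] inj_eq[OF g(1)] e)
  then have card: "card (A i) = a i" "card (B i) = b i" for i
    by (simp_all add: A_def B_def card_image)
  have fin: "finite (A i)" "finite (B i)" for i by (simp_all add: A_def B_def)
  have "gdegree m n I (S i) = d i" for i
  proof -
    have "gdegree m n I (S i) = (\<Sum>k\<in>A i. if k \<in> I then m else n) + (\<Sum>k\<in>B i. if k \<in> I then m else n)"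
      unfolding gdegree_def S using sub[of i] by (intro sum.union_disjoint fin) blast
    also have "(\<Sum>k\<in>A i. if k \<in> I then m else n) = (\<Sum>k\<in>A i. m)"
      using sub[of i] by (intro sum.cong) auto
    also have "(\<Sum>k\<in>B i. if k \<in> I then m else n) = (\<Sum>k\<in>B i. n)"
      using sub[of i] by (intro sum.cong) auto
    finally show ?thesis using ab(2)[of i] by (simp add: card)
  qed
  moreover have "S i \<noteq> {||}" for i
    using S[of i] card(1)[of i] ab(1)[of i] by auto
  moreover have "S i |\<inter>| S j = {||}" if "i \<noteq> j" for i j
  proof -
    have "A i \<inter> A j = {}" "B i \<inter> B j = {}"
      using that f(1) g(1) by (auto simp: A_def B_def inj_eq e)
    then have "fset (S i) \<inter> fset (S j) = {}"
      using sub[of i] sub[of j] unfolding S by blast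
    then show ?thesis by (metis bot_fset.rep_eq fset_inject inf_fset.rep_eq)
  qed
  ultimately show ?thesis by blast
qed

text \<open>The binomial theorem, cut off after the linear term in \<open>h\<close>.\<close>

lemma power_add_square_zero:
  fixes a h :: "'a::ring_1"
  assumes "a * h = h * a" "h * h = 0"
  shows "(a + h) ^ Suc j = a ^ Suc j + of_nat (Suc j) * a ^ j * h"
proof (induction j)
  case 0
  show ?case by simp
next
  case (Suc j)
  have "h * a ^ k = a ^ k * h" for k
    using assms(1) by (metis power_commuting_commutes)
  have "(a + h) ^ Suc (Suc j) = (a ^ Suc j + of_nat (Suc j) * a ^ j * h) * (a + h)"
    by (subst power_Suc2) (simp only: Suc)
  also have "\<dots> = a ^ Suc j * a + a ^ Suc j * h + of_nat (Suc j) * a ^ j * (h * a)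
      + of_nat (Suc j) * a ^ j * (h * h)"
    by (simp only: distrib_left distrib_right mult.assoc add_ac)
  also have "\<dots> = a ^ Suc (Suc j) + a ^ Suc j * h + of_nat (Suc j) * (a ^ j * a) * h"
    by (simp only: assms(2) assms(1)[symmetric] power_Suc2 mult.assoc) simp
  also have "\<dots> = a ^ Suc (Suc j) + of_nat (Suc (Suc j)) * a ^ Suc j * h"
    by (simp only: power_Suc2[symmetric] of_nat_Suc[of "Suc j"] distrib_right mult_1_left add.assoc)
  finally show ?case .
qed

text \<open>In the expansion of the \<open>k\<close>-th power only the products of all \<open>k\<close> summands survive,
  one for each permutation; in the next power none does. The two claims are proved by a joint induction,
  since by the preceding lemma the induction step for the first uses the second.\<close>

lemma power_sum_square_zero:
  fixes g :: "nat \<Rightarrow> 'a::ring_1"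
  assumes "\<And>s t. s < k \<Longrightarrow> t < k \<Longrightarrow> g s * g t = g t * g s" "\<And>t. t < k \<Longrightarrow> g t * g t = 0"
  shows "(\<Sum>t<k. g t) ^ k = of_nat (fact k) * prod_list (map g [0..<k])
    \<and> (\<Sum>t<k. g t) ^ Suc k = 0"
  using assms
proof (induction k)
  case 0
  show ?case by simp
next
  case (Suc k)
  define a where "a = (\<Sum>t<k. g t)"
  have IH: "a ^ k = of_nat (fact k) * prod_list (map g [0..<k])" "a ^ Suc k = 0"
    unfolding a_def using Suc.IH Suc.prems by (simp_all del: power_Suc)
  have comm: "a * g k = g k * a"
    unfolding a_def sum_distrib_left sum_distrib_right using Suc.prems by (intro sum.cong) auto
  have sq: "g k * g k = 0" using Suc.prems(2) by simp
  have "(a + g k) ^ Suc k = of_nat (Suc k) * a ^ k * g k"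
    by (simp only: power_add_square_zero[OF comm sq] IH(2) add_0)
  moreover have "(a + g k) ^ Suc (Suc k) = 0"
    using IH(2) by (simp add: power_add_square_zero[OF comm sq] del: power_Suc) simp
  ultimately show ?case
    by (simp add: IH(1) mult.assoc fact_Suc of_nat_mult flip: a_def
        del: power_Suc of_nat_Suc of_nat_add mult_Suc)
qed

text \<open>Blades with prescribed support: nonzero multiples of a basis element, which track
  nonvanishing through products without computing signs.\<close>

definition is_blade :: "nat set \<Rightarrow> 'f::field grassmann \<Rightarrow> bool" where
  "is_blade A p \<longleftrightarrow> (\<exists>c S. c \<noteq> 0 \<and> fset S = A \<and> p = gscale c (gbasis S))"

lemma is_blade_nonzero:
  fixes p :: "'f::field grassmann"
  assumes "is_blade A p"
  shows "p \<noteq> 0"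
proof -
  have "gbasis S \<noteq> (0 :: 'f grassmann)" for S
    by transfer (metis lookup_single_eq lookup_zero zero_neq_one)
  then show ?thesis using assms by (auto simp: is_blade_def)
qed

lemma is_blade_gbasis: "is_blade (fset S) (gbasis S)"
  unfolding is_blade_def by (intro exI[of _ 1] exI[of _ S]) simp

lemma is_blade_scale: "c \<noteq> 0 \<Longrightarrow> is_blade A p \<Longrightarrow> is_blade A (gscale c p)"
  unfolding is_blade_def by (metis grassmann.scale_scale mult_eq_0_iff)

lemma is_blade_mult:
  assumes "is_blade A p" "is_blade B q" "A \<inter> B = {}"
  shows "is_blade (A \<union> B) (p * q)"
proof -
  obtain c S where p: "c \<noteq> 0" "fset S = A" "p = gscale c (gbasis S)"
    using assms(1) by (auto simp: is_blade_def)
  obtain d T where q: "d \<noteq> 0" "fset T = B" "q = gscale d (gbasis T)"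
    using assms(2) by (auto simp: is_blade_def)
  have "S |\<inter>| T = {||}" using p q assms(3) by (metis bot_fset.rep_eq fset_inject inf_fset.rep_eq)
  then have "gsign S T \<noteq> (0 :: 'a)" by (simp add: gsign_def)
  then show ?thesis
    unfolding is_blade_def using p q
    by (intro exI[of _ "c * (d * gsign S T)"] exI[of _ "S |\<union>| T"])
      (simp add: gscale_mult_left gscale_mult_right gbasis_mult mult_ac)
qed

lemma is_blade_prod_list:
  assumes "distinct xs" "\<And>x. x \<in> set xs \<Longrightarrow> is_blade (A x) (p x)" "disjoint_family_on A (set xs)"
  shows "is_blade (\<Union>x\<in>set xs. A x) (prod_list (map p xs))"
  using assms
proof (induction xs)
  case Nil
  show ?case using is_blade_gbasis[of "{||}"] by (simp add: gbasis_empty)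
next
  case (Cons x xs)
  then have "is_blade (\<Union>x\<in>set xs. A x) (prod_list (map p xs))"
    by (simp add: disjoint_family_on_def)
  moreover have "A x \<inter> (\<Union>x\<in>set xs. A x) = {}"
    using Cons.prems by (fastforce simp: disjoint_family_on_def)
  ultimately show ?case using Cons.prems by (simp add: is_blade_mult)
qed

lemma mset_concat_replicate_remdups:
  "mset (concat (map (\<lambda>x. replicate (count (mset w) x) x) (remdups w))) = mset w"
proof -
  have "count (mset (concat (map (\<lambda>x. replicate (k x) x) xs))) y = (if y \<in> set xs then k y else 0)"
    if "distinct xs" for xs :: "'a list" and k y
    using that by (induction xs) auto
  then show ?thesis by (intro multiset_eqI) (auto simp: count_eq_zero_iff)
qed

text \<open>The generic values adapted to the word \<open>w\<close>. The hypothesis on odd variables is what makes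
  the summands of each value commute: the value of an odd variable has at most one summand.\<close>

lemma separating_evaluation:
  assumes "m < 0" "0 < n" "odd m" "odd n" "gcd m n = 1" "infinite I" "infinite (- I)"
    and odd1: "\<And>x. odd (vdegree x) \<Longrightarrow> count (mset w) x \<le> 1"
  obtains \<phi> :: "gvar \<Rightarrow> 'f::field_char_0 grassmann"
  where "\<And>x. \<phi> x \<in> gcomponent m n I (vdegree x)" "prod_list (map \<phi> w) \<noteq> 0"
    "\<And>x. \<phi> x ^ Suc (count (mset w) x) = 0"
proof -
  obtain S' :: "int \<times> nat \<times> nat \<Rightarrow> nat fset"
    where S': "\<And>i. S' i \<noteq> {||}" "\<And>i. gdegree m n I (S' i) = fst i"
      "\<And>i j. i \<noteq> j \<Longrightarrow> S' i |\<inter>| S' j = {||}"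
    using exists_disjoint_family_of_degrees[OF assms(1,2,5-7), of fst] by metis
  define S where "S x t = S' (vdegree x, vindex x, t)" for x t
  have S_ne: "S x t \<noteq> {||}" and S_deg: "gdegree m n I (S x t) = vdegree x" for x t
    by (simp_all add: S_def S')
  have S_disj: "fset (S x t) \<inter> fset (S y u) = {}" if "x \<noteq> y \<or> t \<noteq> u" for x t y u
  proof -
    have "S x t |\<inter>| S y u = {||}"
      unfolding S_def using that by (intro S'(3)) (auto intro: gvar.expand)
    then show ?thesis by (metis bot_fset.rep_eq inf_fset.rep_eq)
  qed
  define k where "k = count (mset w)"
  define \<phi> :: "gvar \<Rightarrow> 'f grassmann" where "\<phi> x = (\<Sum>t<k x. gbasis (S x t))" for x
  have hom: "gbasis (S x t) \<in> gcomponent m n I (vdegree x)" for x t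
    using gbasis_in_gcomponent[of "S x t" m n I] by (simp add: S_deg)
  then have \<phi>: "\<phi> x \<in> gcomponent m n I (vdegree x)" for x
    unfolding \<phi>_def gcomponent_def by (intro grassmann.span_sum)
  have pow: "\<phi> x ^ k x = of_nat (fact (k x)) * prod_list (map (\<lambda>t. gbasis (S x t)) [0..<k x])
      \<and> \<phi> x ^ Suc (k x) = 0" for x
    unfolding \<phi>_def
  proof (rule power_sum_square_zero)
    show "gbasis (S x t) * gbasis (S x t) = (0 :: 'f grassmann)" for t
      using S_ne[of x t] by (simp add: gbasis_mult gsign_def)
    show "gbasis (S x s) * gbasis (S x t) = (gbasis (S x t) * gbasis (S x s) :: 'f grassmann)"
      if "s < k x" "t < k x" for s t
    proof (cases "odd (vdegree x)")
      case True
      then have "s = t" using that odd1[OF True] by (simp add: k_def)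
      then show ?thesis by simp
    next
      case False
      then show ?thesis
        using gcomponent_supercommute[OF assms(3,4) hom[of x s] hom[of x t]] by simp
    qed
  qed
  have "is_blade (\<Union>t\<in>set [0..<k x]. fset (S x t)) (prod_list (map (\<lambda>t. gbasis (S x t)) [0..<k x]) :: 'f grassmann)" for x
    by (rule is_blade_prod_list) (auto simp: is_blade_gbasis disjoint_family_on_def S_disj)
  moreover have "of_nat j * p = gscale (of_nat j) p" for j and p :: "'f grassmann"
    by (induction j) (simp_all add: distrib_right grassmann.scale_left_distrib)
  ultimately have "is_blade (\<Union>t\<in>set [0..<k x]. fset (S x t)) (\<phi> x ^ k x)" for x
    using pow[of x] by (simp add: is_blade_scale)
  then have "is_blade (\<Union>x\<in>set (remdups w). \<Union>t\<in>set [0..<k x]. fset (S x t))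
      (prod_list (map (\<lambda>x. \<phi> x ^ k x) (remdups w)))"
    by (intro is_blade_prod_list) (use S_disj in \<open>auto simp: disjoint_family_on_def\<close>, blast)
  then have nz: "prod_list (map (\<lambda>x. \<phi> x ^ k x) (remdups w)) \<noteq> 0" by (rule is_blade_nonzero)
  have "prod_list (map \<phi> (concat (map (\<lambda>x. replicate (k x) x) xs))) = prod_list (map (\<lambda>x. \<phi> x ^ k x) xs)" for xs
    by (induction xs) (simp_all add: prod_list_replicate)
  \<comment> \<open>\<open>w\<close> is compared with its rearrangement in which equal letters are adjacent\<close>
  with nz have "prod_list (map \<phi> (concat (map (\<lambda>x. replicate (k x) x) (remdups w)))) \<noteq> 0" by simp
  moreover obtain c where "c \<noteq> 0" "prod_list (map \<phi> w) =
      gscale c (prod_list (map \<phi> (concat (map (\<lambda>x. replicate (k x) x) (remdups w)))))"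
    using prod_list_values_perm[OF assms(3,4) \<phi> mset_concat_replicate_remdups[of w, symmetric]]
    unfolding k_def by blast
  ultimately have "prod_list (map \<phi> w) \<noteq> 0" by simp
  then show thesis using \<phi> pow by (intro that[of \<phi>]) (auto simp: k_def simp del: power_Suc)
qed

lemma prod_list_values_eq_0:
  fixes \<phi> :: "gvar \<Rightarrow> 'f::field grassmann"
  assumes "odd m" "odd n" "\<And>x. \<phi> x \<in> gcomponent m n I (vdegree x)"
    and "\<phi> x ^ k = 0" "k \<le> count (mset v) x"
  shows "prod_list (map \<phi> v) = 0"
proof -
  have "replicate_mset k x \<subseteq># mset v"
    using assms(5) by (simp add: count_le_replicate_mset_subset_eq)
  then obtain M where "mset v = replicate_mset k x + M" by (metis subset_mset.le_iff_add)
  moreover obtain u where "mset u = M" by (metis ex_mset)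
  ultimately have "mset v = mset (replicate k x @ u)" by simp
  from prod_list_values_perm[OF assms(1-3) this] show ?thesis
    by (auto simp: assms(4))
qed

lemma exists_larger_count:
  assumes "size M \<le> size N" "N \<noteq> M"
  shows "\<exists>x. count M x < count N x"
proof (rule ccontr)
  assume "\<not> ?thesis"
  then have "N \<subseteq># M" by (simp add: subseteq_mset_def not_less)
  then show False using assms mset_subset_size[of N M] by (metis leD subset_mset.less_le)
qed

text \<open>The evaluation adapted to a shortest word kills all other words. For that minimality of the
  length is enough, as a word of different content that is not shorter must exceed \<open>w\<close> in some
  variable.\<close>

lemma not_graded_identity_if_distinct_contents:
  fixes f :: "'f::field_char_0 gfree"
  assumes "m < 0" "0 < n" "odd m" "odd n" "gcd m n = 1" "infinite I" "infinite (- I)"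
    and "f \<noteq> 0"
    and odd1: "\<And>w x. w \<in> Poly_Mapping.keys f \<Longrightarrow> odd (vdegree x) \<Longrightarrow> count (mset (letters w)) x \<le> 1"
    and inj: "inj_on (\<lambda>w. mset (letters w)) (Poly_Mapping.keys f)"
  shows "f \<notin> graded_identities gscale (gcomponent m n I)"
proof -
  let ?K = "Poly_Mapping.keys f"
  obtain w0 where "w0 \<in> ?K" using \<open>f \<noteq> 0\<close> by (metis all_not_in_conv keys_eq_empty)
  then obtain w where w: "w \<in> ?K" and min: "\<And>v. v \<in> ?K \<Longrightarrow> length (letters w) \<le> length (letters v)"
    using ex_has_least_nat[of "\<lambda>w. w \<in> ?K" w0 "\<lambda>w. length (letters w)"] by blast
  obtain \<phi> :: "gvar \<Rightarrow> 'f grassmann"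
    where \<phi>: "\<And>x. \<phi> x \<in> gcomponent m n I (vdegree x)"
      and nz: "prod_list (map \<phi> (letters w)) \<noteq> 0"
      and nilp: "\<And>x. \<phi> x ^ Suc (count (mset (letters w)) x) = 0"
    using separating_evaluation[OF assms(1-7) odd1[OF w]] by metis
  have "prod_list (map \<phi> (letters v)) = 0" if v: "v \<in> ?K - {w}" for v
  proof -
    have "mset (letters v) \<noteq> mset (letters w)" using v w inj by (auto dest: inj_onD)
    then obtain x where "count (mset (letters w)) x < count (mset (letters v)) x"
      using exists_larger_count[of "mset (letters w)" "mset (letters v)"] min[of v] v by auto
    then show ?thesis
      by (intro prod_list_values_eq_0[OF assms(3,4) \<phi> nilp] Suc_leI)
  qed
  then have "poly_eval gscale \<phi> f =
      gscale (Poly_Mapping.lookup f w) (prod_list (map \<phi> (letters w)))"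
    unfolding poly_eval_def by (subst sum.remove[OF _ w]) simp_all
  moreover have "\<dots> \<noteq> 0" using nz w by (simp add: in_keys_iff)
  ultimately have "poly_eval gscale \<phi> f \<noteq> 0" by simp
  then show ?thesis using \<phi> unfolding graded_identities_def by blast
qed

text \<open>A representative with as few words as possible is reduced: a word with a repeated odd variable
  could be dropped, and one of two words with equal content could be replaced by a multiple of the other.\<close>

lemma reduce_modulo_V2_ideal:
  fixes f :: "'f::field_char_0 gfree"
  obtains g where "f - g \<in> V2_ideal"
    "\<And>w x. w \<in> Poly_Mapping.keys g \<Longrightarrow> odd (vdegree x) \<Longrightarrow> count (mset (letters w)) x \<le> 1"
    "inj_on (\<lambda>w. mset (letters w)) (Poly_Mapping.keys g)"
proof -
  let ?C = "{g. f - g \<in> V2_ideal}"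
  have ideal: "TZ_ideal (V2_ideal :: 'f gfree set)" by (rule TZ_ideal_generated)
  have "f \<in> ?C" using ideal by (simp add: TZ_ideal_def two_sided_ideal_def)
  then obtain g where g: "f - g \<in> V2_ideal"
    and min: "\<And>h. f - h \<in> V2_ideal \<Longrightarrow> card (Poly_Mapping.keys g) \<le> card (Poly_Mapping.keys h)"
    using ex_has_least_nat[of "\<lambda>g. g \<in> ?C" f "\<lambda>g. card (Poly_Mapping.keys g)"] by blast
  let ?K = "Poly_Mapping.keys g"
  \<comment> \<open>minimality: no word of \<open>g\<close> can be eliminated using only words of \<open>g\<close>\<close>
  have no_removal: False
    if p: "p \<in> V2_ideal" and w: "w \<in> ?K" and v: "Poly_Mapping.lookup p w = 1"
      "Poly_Mapping.keys p \<subseteq> ?K" for p :: "'f gfree" and w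
  proof -
    let ?h = "g - pm_scale (Poly_Mapping.lookup g w) p"
    have "f - ?h = (f - g) + pm_scale (Poly_Mapping.lookup g w) p" by simp
    also have "\<dots> \<in> V2_ideal" by (intro TZ_ideal_add TZ_ideal_scale ideal g p)
    finally have "card ?K \<le> card (Poly_Mapping.keys ?h)" by (rule min)
    moreover have "Poly_Mapping.keys ?h \<subseteq> ?K" "w \<notin> Poly_Mapping.keys ?h"
      using v by (auto simp: in_keys_iff lookup_minus subset_iff)
    then have "Poly_Mapping.keys ?h \<subset> ?K" using w by blast
    then have "card (Poly_Mapping.keys ?h) < card ?K" by (simp add: psubset_card_mono)
    ultimately show False by simp
  qed
  show thesis
  proof
    show "f - g \<in> V2_ideal" by (rule g)
    show "count (mset (letters w)) x \<le> 1" if "w \<in> ?K" "odd (vdegree x)" for w x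
    proof (rule ccontr)
      assume "\<not> ?thesis"
      then have "monomial (letters w) \<in> (V2_ideal :: 'f gfree set)"
        using that by (intro monomial_repeated_odd[of x]) auto
      then show False
        using that by (elim no_removal[of _ w]) (auto simp: monomial_def)
    qed
    show "inj_on (\<lambda>w. mset (letters w)) ?K"
    proof (rule inj_onI, rule ccontr)
      fix v w assume vw: "v \<in> ?K" "w \<in> ?K" "mset (letters v) = mset (letters w)" "v \<noteq> w"
      then obtain c :: 'f where c: "monomial (letters v) - pm_scale c (monomial (letters w)) \<in> V2_ideal"
        using scalar_cong_mset[OF vw(3), of "TYPE('f)"] unfolding scalar_cong_def by blast
      have "Poly_Mapping.lookup (monomial (letters v) - pm_scale c (monomial (letters w))) u =
          (if u = v then 1 else if u = w then - c else 0)" for u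
        using vw(4) by (simp add: monomial_def lookup_minus lookup_single)
      then show False
        using vw by (intro no_removal[OF c, of v]) (auto simp: in_keys_iff split: if_splits)
    qed
  qed
qed

section \<open>The graded identities of the Grassmann algebra\<close>

theorem theorem3p17:
  fixes m n :: int and I :: "nat set"
  assumes "m < 0" and "0 < n" and "odd m" and "odd n" and "gcd m n = 1"
    and "infinite I" and "infinite (- I)"
  shows "graded_identities gscale
           (gcomponent m n I :: int \<Rightarrow> 'f::field_char_0 grassmann set)
         = TZ_generated V2_identities"
proof
  let ?T = "graded_identities gscale (gcomponent m n I :: int \<Rightarrow> 'f grassmann set)"
  have T: "TZ_ideal ?T" by (rule TZ_ideal_graded_identities)
  show sub: "V2_ideal \<subseteq> ?T"
    by (rule TZ_generated_least[OF T V2_subset_graded_identities[OF assms(3,4)]])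
  show "?T \<subseteq> V2_ideal"
  proof
    fix f assume f: "f \<in> ?T"
    obtain g where g: "f - g \<in> V2_ideal"
        "\<And>w x. w \<in> Poly_Mapping.keys g \<Longrightarrow> odd (vdegree x) \<Longrightarrow> count (mset (letters w)) x \<le> 1"
        "inj_on (\<lambda>w. mset (letters w)) (Poly_Mapping.keys g)"
      using reduce_modulo_V2_ideal[of f] by metis
    have "f - (f - g) \<in> ?T" using TZ_ideal_diff[OF T f] g(1) sub by blast
    then have "g \<in> ?T" by simp
    with not_graded_identity_if_distinct_contents[OF assms _ g(2,3)] have "g = 0" by blast
    with g(1) show "f \<in> V2_ideal" by simp
  qed
qed

end
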